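(* Let $\|\cdot\|$ be a norm on $\mathbb{R}^2$ which is not strictly convex. Then for each $n\in\mathbb{N}$ there exist infinitely many (after scaling and translating) line-like configurations of size $n$ in $\|\cdot\|$.
   Context: A norm on $\mathbb{R}^2$ is strictly convex if its unit circle (the boundary of its unit ball) contains no line segment of positive length. A set $S\subset\mathbb{R}^2$ of $n$ points is a line-like configuration of size $n$ in $\|\cdot\|$ if its distance graph is isomorphic to that of $n$ equally spaced points on a line, i.e. there is a bijection $\phi: S\to\{1,\dots,n\}$ such that for all $a,b,c,d\in S$: $\|a-b\|=\|c-d\|$ if and only if $|\phi(a)-\phi(b)|=|\phi(c)-\phi(d)|$. "Infinitely many (after scaling and translating)" means that there are infinitely many such sets no two of which are related by a map $p\mapsto \lambda p+v$ with $\lambda>0$, $v\in\mathbb{R}^2$.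
   Formalization: The claim is proved for n ≥ 2 only; for n = 1 it is false as stated, since any two one-point sets are translates of each other (and for n = 0 only the empty set exists). *)

theory Defs
  imports "HOL-Analysis.Analysis"
begin

text \<open>
  The norm is an arbitrary function \<open>N\<close> on the plane satisfying the norm axioms; the type class
  operation \<open>norm\<close> on \<open>real^2\<close> is only the Euclidean one.
\<close>

definition is_norm :: "(real^2 \<Rightarrow> real) \<Rightarrow> bool" where
  "is_norm N \<longleftrightarrow>
     (\<forall>x. 0 \<le> N x) \<and>
     (\<forall>x. N x = 0 \<longleftrightarrow> x = 0) \<and>
     (\<forall>c x. N (c *\<^sub>R x) = \<bar>c\<bar> * N x) \<and>
     (\<forall>x y. N (x + y) \<le> N x + N y)"

text \<open>
  The boundary is taken in the standard topology of the plane, which is the one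
  induced by any norm.
\<close>

definition unit_circle :: "(real^2 \<Rightarrow> real) \<Rightarrow> (real^2) set" where
  "unit_circle N = frontier {x. N x \<le> 1}"

definition strictly_convex_norm :: "(real^2 \<Rightarrow> real) \<Rightarrow> bool" where
  "strictly_convex_norm N \<longleftrightarrow>
     \<not> (\<exists>a b. a \<noteq> b \<and> closed_segment a b \<subseteq> unit_circle N)"

definition line_like_configuration :: "(real^2 \<Rightarrow> real) \<Rightarrow> nat \<Rightarrow> (real^2) set \<Rightarrow> bool" where
  "line_like_configuration N n S \<longleftrightarrow>
     finite S \<and> card S = n \<and>
     (\<exists>\<phi> :: real^2 \<Rightarrow> nat. bij_betw \<phi> S {1..n} \<and>
        (\<forall>a\<in>S. \<forall>b\<in>S. \<forall>c\<in>S. \<forall>d\<in>S.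
           N (a - b) = N (c - d) \<longleftrightarrow>
           \<bar>int (\<phi> a) - int (\<phi> b)\<bar> = \<bar>int (\<phi> c) - int (\<phi> d)\<bar>))"

definition same_up_to_scaling_translation :: "(real^2) set \<Rightarrow> (real^2) set \<Rightarrow> bool" where
  "same_up_to_scaling_translation S T \<longleftrightarrow>
     (\<exists>c::real. \<exists>v. 0 < c \<and> T = (\<lambda>p. c *\<^sub>R p + v) ` S)"

end

theory Submission
  imports Defs
begin

text \<open>
  If the segment from \<open>a\<close> to \<open>b\<close> lies on the unit circle, then every path whose steps belong to that
  segment is an isometric copy of equally spaced points on a line: by convexity the sum of \<open>k\<close> steps
  is \<open>k\<close> times a point of the segment, hence has norm \<open>k\<close>. Walking straight along \<open>a\<close> and
  bending only the last step towards \<open>b\<close> by a parameter \<open>t\<close> gives infinitely many configurations.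
  A homothety between two of them must respect the unique pair of points at maximal distance, so the
  vector joining these two points, and with it \<open>t\<close>, is determined by the homothety class.
\<close>

lemma is_normD:
  assumes "is_norm N"
  shows "0 \<le> N x" "N x = 0 \<longleftrightarrow> x = 0" "N (c *\<^sub>R x) = \<bar>c\<bar> * N x" "N (x + y) \<le> N x + N y"
  using assms unfolding is_norm_def by blast+

lemma is_norm_minus_commute:
  assumes "is_norm N"
  shows "N (x - y) = N (y - x)"
  using is_normD(3)[OF assms, of "-1" "x - y"] by simp

text \<open>A norm is convex, and finite convex functions on an open set in finite dimension are
  continuous. This ties the topological frontier in \<open>unit_circle\<close> to the values of
  \<open>N\<close>.\<close>

lemma continuous_on_is_norm:
  assumes "is_norm N"
  shows "continuous_on UNIV N"
proof (rule convex_on_continuous)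
  show "convex_on UNIV N"
  proof (rule convex_onI)
    fix t :: real and x y :: "real^2"
    assume "0 < t" "t < 1"
    then show "N ((1 - t) *\<^sub>R x + t *\<^sub>R y) \<le> (1 - t) * N x + t * N y"
      using is_normD(4)[OF assms, of "(1 - t) *\<^sub>R x" "t *\<^sub>R y"] by (simp add: is_normD(3)[OF assms])
  qed auto
qed auto

lemma unit_circle_imp_norm_eq_1:
  assumes "is_norm N" and "x \<in> unit_circle N"
  shows "N x = 1"
proof -
  have "closed {x. N x \<le> 1}" "open {x. N x < 1}"
    using continuous_on_is_norm[OF assms(1)]
    by (auto intro!: closed_Collect_le open_Collect_less)
  moreover have "{x. N x < 1} \<subseteq> {x. N x \<le> 1}"
    by auto
  ultimately have "{x. N x < 1} \<subseteq> interior {x. N x \<le> 1}" "closure {x. N x \<le> 1} = {x. N x \<le> 1}"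
    by (simp_all add: interior_maximal)
  then show ?thesis
    using assms(2) unfolding unit_circle_def frontier_def by force
qed

text \<open>The point \<open>y\<close> is the average of the \<open>k\<close> steps, which convexity
  keeps in \<open>C\<close>.\<close>

lemma path_displacement:
  fixes x :: "nat \<Rightarrow> 'a::real_vector"
  assumes "convex C" and "\<And>i. x (Suc i) - x i \<in> C"
  shows "\<exists>y\<in>C. x (i + k) - x i = real k *\<^sub>R y"
proof (induction k)
  case 0
  \<comment> \<open>Any point of \<open>C\<close> serves here; the first step supplies one.\<close>
  then show ?case using assms(2)[of i] by auto
next
  case (Suc k)
  then obtain y where y: "y \<in> C" "x (i + k) - x i = real k *\<^sub>R y" by blast
  define z where "z = x (Suc (i + k)) - x (i + k)"
  \<comment> \<open>Updated average: the old one with weight k/(k+1), the new step with weight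
    1/(k+1).\<close>
  let ?w = "(real k / real (Suc k)) *\<^sub>R y + (1 / real (Suc k)) *\<^sub>R z"
  have "?w \<in> C"
    using assms(2)[of "i + k"] y(1) by (intro convexD[OF assms(1)]) (auto simp: z_def field_simps)
  moreover have "x (i + Suc k) - x i = real (Suc k) *\<^sub>R ?w"
  proof -
    have "x (i + Suc k) - x i = real k *\<^sub>R y + z"
      using y(2) by (simp add: z_def algebra_simps)
    then show ?thesis by (simp add: scaleR_add_right del: of_nat_Suc)
  qed
  ultimately show ?case by blast
qed

lemma path_distance:
  assumes "is_norm N" and "convex C" and "\<And>y. y \<in> C \<Longrightarrow> N y = 1"
    and "\<And>i. x (Suc i) - x i \<in> C"
  shows "N (x i - x j) = \<bar>real i - real j\<bar>"
proof (induction i j rule: linorder_wlog)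
  case (le i j)
  obtain y where "y \<in> C" "x (i + (j - i)) - x i = real (j - i) *\<^sub>R y"
    using path_displacement[of C x, OF assms(2,4)] by blast
  then have "N (x j - x i) = real (j - i)"
    using le by (simp add: is_normD(3)[OF assms(1)] assms(3))
  then show ?case
    using le is_norm_minus_commute[OF assms(1), of "x i" "x j"] by simp
next
  case (sym i j)
  then show ?case
    using is_norm_minus_commute[OF assms(1), of "x i" "x j"] by simp
qed

lemma line_like_configuration_isometric_image:
  assumes "is_norm N" and dist: "\<And>i j. N (x i - x j) = \<bar>real i - real j\<bar>"
  shows "line_like_configuration N (Suc m) (x ` {..m})"
proof -
  have inj: "inj x"
  proof (rule injI)
    fix i j assume "x i = x j"
    then show "i = j" using dist[of i j] is_normD(2)[OF assms(1), of 0] by simp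
  qed
  \<comment> \<open>Path indices start at 0, labels at 1; the shift cancels in differences.\<close>
  let ?\<phi> = "\<lambda>p. Suc (inv x p)"
  have "bij_betw ?\<phi> (x ` {..m}) {1..Suc m}"
  proof (rule bij_betwI')
    fix k assume "k \<in> {1..Suc m}"
    then show "\<exists>p\<in>x ` {..m}. k = ?\<phi> p"
      by (intro bexI[of _ "x (k - 1)"]) (auto simp: inv_f_f[OF inj])
  qed (auto simp: inv_f_f[OF inj])
  moreover have "\<forall>a\<in>x ` {..m}. \<forall>b\<in>x ` {..m}. \<forall>c\<in>x ` {..m}. \<forall>d\<in>x ` {..m}.
      N (a - b) = N (c - d) \<longleftrightarrow>
      \<bar>int (?\<phi> a) - int (?\<phi> b)\<bar> = \<bar>int (?\<phi> c) - int (?\<phi> d)\<bar>"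
    by (auto simp: inv_f_f[OF inj] dist)
  moreover have "card (x ` {..m}) = Suc m"
    using inj by (simp add: card_image inj_on_subset)
  ultimately show ?thesis
    unfolding line_like_configuration_def by blast
qed

text \<open>Both sets have diameter \<open>m\<close>, so the scaling factor is 1. Only the two
  endpoints are at distance \<open>m\<close>, so they correspond, possibly in swapped order.\<close>

lemma homothetic_isometric_images_endpoints:
  assumes "is_norm N" and "0 < m"
    and dx: "\<And>i j. N (x i - x j) = \<bar>real i - real j\<bar>"
    and dy: "\<And>i j. N (y i - y j) = \<bar>real i - real j\<bar>"
    and "same_up_to_scaling_translation (x ` {..m}) (y ` {..m})"
  shows "y m - y 0 = x m - x 0 \<or> y m - y 0 = - (x m - x 0)"
proof -
  obtain c v where c: "0 < c" and img: "y ` {..m} = (\<lambda>p. c *\<^sub>R p + v) ` x ` {..m}"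
    using assms(5) unfolding same_up_to_scaling_translation_def by blast
  have "\<exists>i\<le>m. y l = c *\<^sub>R x i + v" if "l \<le> m" for l
    using that img by (auto simp: set_eq_iff image_iff)
  then obtain i j where ij: "i \<le> m" "j \<le> m" "y m = c *\<^sub>R x i + v" "y 0 = c *\<^sub>R x j + v"
    by (meson le_refl le0)
  have "\<exists>k\<le>m. c *\<^sub>R x l + v = y k" if "l \<le> m" for l
    using that img by (auto simp: set_eq_iff image_iff)
  then obtain k l where kl: "k \<le> m" "l \<le> m" "c *\<^sub>R x m + v = y k" "c *\<^sub>R x 0 + v = y l"
    by (meson le_refl le0)
  have y_diff: "y m - y 0 = c *\<^sub>R (x i - x j)"
    using ij by (simp add: algebra_simps)
  then have m_eq: "real m = c * \<bar>real i - real j\<bar>"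
    using dy[of m 0] c by (simp add: is_normD(3)[OF assms(1)] dx)
  \<comment> \<open>The images of the endpoints of \<open>x\<close> are at distance
    \<open>c * m\<close>, at most the diameter \<open>m\<close> of the target; hence
    \<open>c \<le> 1\<close>.\<close>
  have "y k - y l = c *\<^sub>R (x m - x 0)"
    using kl(3,4)[symmetric] by (simp add: algebra_simps)
  then have "c * real m = \<bar>real k - real l\<bar>"
    using dy[of k l] c by (simp add: is_normD(3)[OF assms(1)] dx)
  then have "c * real m \<le> 1 * real m"
    using kl(1,2) by simp
  then have "c \<le> 1"
    using assms(2) by simp
  \<comment> \<open>Conversely, the preimages of the endpoints of \<open>y\<close> are at distance
    at most \<open>m\<close>, which gives \<open>c \<ge> 1\<close>.\<close>
  have ij_le: "\<bar>real i - real j\<bar> \<le> real m"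
    using ij(1,2) by simp
  then have "1 * real m \<le> c * real m"
    using m_eq mult_left_mono[OF ij_le, of c] c by simp
  then have "c = 1"
    using \<open>c \<le> 1\<close> assms(2) by simp
  then have "i = m \<and> j = 0 \<or> i = 0 \<and> j = m"
    using m_eq ij(1,2) by (auto simp: abs_if split: if_splits)
  then show ?thesis
    using y_diff \<open>c = 1\<close> by auto
qed

text \<open>The shift by \<open>t *\<^sub>R (b - a)\<close> persists beyond \<open>m\<close>, so
  only the step into \<open>m\<close> is bent and every later step is \<open>a\<close> again. The
  path is thus infinite with all steps in the segment, and its distance formula needs no index
  bounds.\<close>

definition bent_path :: "'a::real_vector \<Rightarrow> 'a \<Rightarrow> nat \<Rightarrow> real \<Rightarrow> nat \<Rightarrow> 'a" where
  "bent_path a b m t i = real i *\<^sub>R a + (if m \<le> i then t *\<^sub>R (b - a) else 0)"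

lemma bent_path_step:
  assumes "0 \<le> t" and "t \<le> 1"
  shows "bent_path a b m t (Suc i) - bent_path a b m t i \<in> closed_segment a b"
proof -
  have "bent_path a b m t (Suc i) - bent_path a b m t i
      = (if Suc i = m then (1 - t) *\<^sub>R a + t *\<^sub>R b else a)"
    by (auto simp: bent_path_def algebra_simps)
  then show ?thesis
    using assms by (cases "Suc i = m") (auto simp: in_segment(1)[of "(1 - t) *\<^sub>R a + t *\<^sub>R b"])
qed

theorem theorem1p2:
  fixes N :: "real^2 \<Rightarrow> real" and n :: nat
  assumes "is_norm N"
    and "\<not> strictly_convex_norm N"
    and "n \<ge> 2"
  shows "\<exists>\<F> :: (real^2) set set.
           infinite \<F> \<and>
           (\<forall>S\<in>\<F>. line_like_configuration N n S) \<and>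
           pairwise (\<lambda>S T. \<not> same_up_to_scaling_translation S T) \<F>"
proof -
  obtain a b where "a \<noteq> b" and seg: "\<And>y. y \<in> closed_segment a b \<Longrightarrow> N y = 1"
    using assms(2) unit_circle_imp_norm_eq_1[OF assms(1)]
    unfolding strictly_convex_norm_def by blast
  \<comment> \<open>A path through \<open>n\<close> points has \<open>m\<close> steps;
    \<open>0 < m\<close> guarantees a last step to bend.\<close>
  obtain m where n: "n = Suc m" and m: "0 < m"
    using assms(3) by (cases n) auto
  let ?x = "bent_path a b m"
  define S where "S t = ?x t ` {..m}" for t
  have dist: "N (?x t i - ?x t j) = \<bar>real i - real j\<bar>" if "t \<in> {0..1}" for t i j
    using that
    by (intro path_distance[where C = "closed_segment a b"])
      (simp_all add: assms(1) seg bent_path_step)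
  have diff: "?x t m - ?x t 0 = real m *\<^sub>R a + t *\<^sub>R (b - a)" for t
    using m by (simp add: bent_path_def)
  have inj: "s = t" if st: "s \<in> {0..1}" "t \<in> {0..1}"
    and "same_up_to_scaling_translation (S s) (S t)" for s t
  proof -
    have "?x t m - ?x t 0 = ?x s m - ?x s 0 \<or> ?x t m - ?x t 0 = - (?x s m - ?x s 0)"
      using that homothetic_isometric_images_endpoints[OF assms(1) m dist dist] unfolding S_def by blast
    then show ?thesis
    proof
      assume "?x t m - ?x t 0 = ?x s m - ?x s 0"
      then show ?thesis using \<open>a \<noteq> b\<close> by (simp add: diff)
    next
      assume *: "?x t m - ?x t 0 = - (?x s m - ?x s 0)"
      \<comment> \<open>Opposite endpoint vectors would put the origin on the segment.\<close>
      define r where "r = (s + t) / (2 * real m)"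
      \<comment> \<open>The upper bound holds since s + t \<le> 2 \<le> 2m.\<close>
      have r: "0 \<le> r" "r \<le> 1"
        using st m by (auto simp: r_def field_simps)
      have "(2 * real m) *\<^sub>R ((1 - r) *\<^sub>R a + r *\<^sub>R b)
          = (2 * real m) *\<^sub>R a + (2 * real m * r) *\<^sub>R (b - a)"
        by (simp add: algebra_simps)
      also have "2 * real m * r = s + t"
        using m by (simp add: r_def)
      also have "(2 * real m) *\<^sub>R a + (s + t) *\<^sub>R (b - a)
          = (?x t m - ?x t 0) + (?x s m - ?x s 0)"
        unfolding diff by (simp add: algebra_simps flip: scaleR_add_left)
      also have "\<dots> = 0"
        using * by simp
      finally have "(1 - r) *\<^sub>R a + r *\<^sub>R b = 0"
        using m by simp
      then have "0 \<in> closed_segment a b"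
        using r unfolding closed_segment_def by force
      then show ?thesis
        using seg is_normD(2)[OF assms(1), of 0] by force
    qed
  qed
  \<comment> \<open>Equal sets are homothetic, so \<open>inj\<close> yields injectivity of
    \<open>S\<close> as well as pairwise inequivalence.\<close>
  have refl: "same_up_to_scaling_translation T T" for T
    unfolding same_up_to_scaling_translation_def by (intro exI[of _ 1] exI[of _ 0]) auto
  have "inj_on S {0..1}"
    using inj refl by (metis inj_onI)
  then have "infinite (S ` {0..1})"
    by (simp add: finite_image_iff infinite_Icc)
  moreover have "\<forall>T\<in>S ` {0..1}. line_like_configuration N n T"
    using line_like_configuration_isometric_image[OF assms(1) dist] unfolding S_def n by blast
  moreover have "pairwise (\<lambda>S T. \<not> same_up_to_scaling_translation S T) (S ` {0..1})"
    using inj unfolding pairwise_def by blast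
  ultimately show ?thesis by blast
qed

end
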